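(* Let $(\mathbf{X}_t)$ be a geometric opinion dynamics (as in the context), and suppose there exists an invariant distribution $\mu^*$ with $\mu^*(P^c)>0$. Then there exists a starting configuration $\mathbf{X}_0\in(\mathbb{S}^{d-1})^n$ from which $\mathbf{X}_t$ does not weakly polarize on average. In particular, if the dynamics are continuous (for every fixed $\xi$ and every $i$, $f_i(\cdot,\xi)$ is continuous on $(\mathbb{S}^{d-1})^n$), then the dynamics weakly polarize on average from every starting configuration if and only if every invariant distribution is supported on $P$.
   Context: Fix $n,d\ge1$. A geometric opinion dynamics is the Markov chain $\mathbf{X}_t=(\mathbf{X}_t^{(1)},\ldots,\mathbf{X}_t^{(n)})$ on $(\mathbb{S}^{d-1})^n$ given by $\mathbf{X}_{t+1}^{(i)}=P_{\mathbb{S}^{d-1}}\big(\mathbf{X}_t^{(i)}+f_i(\mathbf{X}_t^{(1)},\ldots,\mathbf{X}_t^{(n)},\xi_t)\big)$, with $P_{\mathbb{S}^{d-1}}(\mathbf{x})=\mathbf{x}/\|\mathbf{x}\|_2$, $\xi_t\in\mathbb{S}^{d-1}$ i.i.d. from a fixed distribution $\mathcal{D}$ independent of everything else, each $f_i:(\mathbb{S}^{d-1})^{n+1}\to\mathbb{R}^d$ a fixed measurable function, and the unnormalized vector assumed always nonzero. An invariant distribution is a probability measure $\mu$ on $(\mathbb{S}^{d-1})^n$ such that $\mathbf{X}_0\sim\mu$ implies $\mathbf{X}_1\sim\mu$. $P=\{(\sigma_1\mathbf{x},\ldots,\sigma_n\mathbf{x}):\mathbf{x}\in\mathbb{S}^{d-1},\bm{\sigma}\in\{-1,1\}^n\}$,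 $P^c$ its complement in $(\mathbb{S}^{d-1})^n$, $\rho(\mathbf{z},P)=\inf_{\mathbf{y}\in P}\|\mathbf{z}-\mathbf{y}\|_2$. The chain weakly polarizes on average from $\mathbf{X}_0$ if for every $\epsilon>0$, $\lim_{T\to\infty}\frac1T\mathbb{E}[\sum_{t=1}^T I_{P_\epsilon}(\mathbf{X}_t)]=1$, where $P_\epsilon=\{\mathbf{z}:\rho(\mathbf{z},P)\le\epsilon\}$ and $I_{P_\epsilon}$ is its indicator. *)

theory Defs
  imports "HOL-Probability.Probability"
begin

definition config_space :: "((real^'d::finite)^'n::finite) set" where
  "config_space = {z. \<forall>i. z $ i \<in> sphere 0 1}"

definition polar_set :: "((real^'d::finite)^'n::finite) set" where
  "polar_set = {z. \<exists>x\<in>sphere 0 1. \<exists>\<sigma>::'n \<Rightarrow> real.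
       (\<forall>i. \<sigma> i \<in> {-1, 1}) \<and> z = (\<chi> i. \<sigma> i *\<^sub>R x)}"

definition polar_nbhd :: "real \<Rightarrow> ((real^'d::finite)^'n::finite) set" where
  "polar_nbhd \<epsilon> = {z. infdist z polar_set \<le> \<epsilon>}"

definition proj_sphere :: "real^'d::finite \<Rightarrow> real^'d" where
  "proj_sphere v = (1 / norm v) *\<^sub>R v"

definition god_step ::
  "('n::finite \<Rightarrow> (real^'d::finite)^'n \<Rightarrow> real^'d \<Rightarrow> real^'d)
     \<Rightarrow> (real^'d)^'n \<Rightarrow> real^'d \<Rightarrow> (real^'d)^'n" where
  "god_step f x \<xi> = (\<chi> i. proj_sphere (x $ i + f i x \<xi>))"

definition god_dynamics ::
  "(real^'d::finite) measure \<Rightarrow> ('n::finite \<Rightarrow> (real^'d)^'n \<Rightarrow> real^'d \<Rightarrow> real^'d) \<Rightarrow> bool" where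
  "god_dynamics D f \<longleftrightarrow>
     prob_space D \<and> sets D = sets (restrict_space borel (sphere 0 1)) \<and>
     (\<forall>i. (\<lambda>(x, \<xi>). f i x \<xi>) \<in>
           borel_measurable (restrict_space borel (config_space \<times> sphere 0 1))) \<and>
     (\<forall>x\<in>config_space. \<forall>\<xi>\<in>sphere 0 1. \<forall>i. x $ i + f i x \<xi> \<noteq> 0)"

definition noise_space :: "'a measure \<Rightarrow> (nat \<Rightarrow> 'a) measure" where
  "noise_space D = PiM UNIV (\<lambda>_. D)"

primrec god_traj ::
  "('n::finite \<Rightarrow> (real^'d::finite)^'n \<Rightarrow> real^'d \<Rightarrow> real^'d)
     \<Rightarrow> (real^'d)^'n \<Rightarrow> nat \<Rightarrow> (nat \<Rightarrow> real^'d) \<Rightarrow> (real^'d)^'n" where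
  "god_traj f x0 0 \<omega> = x0"
| "god_traj f x0 (Suc t) \<omega> = god_step f (god_traj f x0 t \<omega>) (\<omega> t)"

definition weakly_polarizes ::
  "(real^'d::finite) measure \<Rightarrow> ('n::finite \<Rightarrow> (real^'d)^'n \<Rightarrow> real^'d \<Rightarrow> real^'d)
     \<Rightarrow> (real^'d)^'n \<Rightarrow> bool" where
  "weakly_polarizes D f x0 \<longleftrightarrow>
     (\<forall>\<epsilon>>0. (\<lambda>T::nat. (1 / real T) *
         (\<integral>\<omega>. (\<Sum>t\<in>{1..T}. indicator (polar_nbhd \<epsilon>) (god_traj f x0 t \<omega>) :: real)
            \<partial>noise_space D)) \<longlonglongrightarrow> 1)"

definition invariant_distribution ::
  "(real^'d::finite) measure \<Rightarrow> ('n::finite \<Rightarrow> (real^'d)^'n \<Rightarrow> real^'d \<Rightarrow> real^'d)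
     \<Rightarrow> ((real^'d)^'n) measure \<Rightarrow> bool" where
  "invariant_distribution D f \<mu> \<longleftrightarrow>
     prob_space \<mu> \<and> sets \<mu> = sets (restrict_space borel config_space) \<and>
     distr (\<mu> \<Otimes>\<^sub>M D) (restrict_space borel config_space) (\<lambda>(x, \<xi>). god_step f x \<xi>) = \<mu>"

end

theory Submission
  imports Defs
begin

text \<open>
  If every starting point polarizes, then integrating the time averages of the indicator of
  \<open>polar_nbhd \<epsilon>\<close> against an invariant distribution gives, by dominated convergence, full mass to
  every \<open>polar_nbhd \<epsilon>\<close>, hence to the closed set \<open>polar_set\<close>. Conversely, a starting point that does
  not polarize yields times along which its occupation measures keep mass away from \<open>polar_set\<close>; a
  weak limit of these is invariant when the dynamics are continuous, and does not live on \<open>polar_set\<close>.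

  Weak compactness on a compact subset of a Euclidean space is reduced to Helly's selection theorem
  on the line: a space-filling curve \<open>\<phi>\<close> covering the compact set has a Borel section (the first
  hitting time), the measures are pulled back along it to \<open>[0, 2]\<close>, and the limit on the line is
  pushed forward by the continuous map \<open>\<phi>\<close>.
\<close>

subsection \<open>A space-filling curve\<close>

text \<open>The cosine makes the function 2-periodic, and clipping produces plateaus: 0 on
  \<open>[0, 1/3]\<close> and 1 on \<open>[2/3, 1]\<close>. It thus reads off the leading ternary
  digit of a number in \<open>[0, 1]\<close> whose ternary digits are all 0 or 2.\<close>

definition bump :: "real \<Rightarrow> real" where
  "bump t = max 0 (min 1 (1 / 2 - cos (pi * t)))"

lemma bump_bounds: "0 \<le> bump t" "bump t \<le> 1"
  by (auto simp: bump_def)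

lemma continuous_on_bump [continuous_intros]:
  fixes A :: "'a::t2_space set"
  shows "continuous_on A f \<Longrightarrow> continuous_on A (\<lambda>x. bump (f x))"
  unfolding bump_def by (intro continuous_intros) auto

lemma bump_add_even: "bump (2 * real m + s) = bump s"
proof -
  have "pi * (2 * real m + s) = 2 * real m * pi + pi * s"
    by (simp add: algebra_simps)
  then have "cos (pi * (2 * real m + s)) = cos (pi * s)"
    by (simp only: cos_add cos_2npi sin_2npi mult_1 mult_zero_left diff_zero)
  then show ?thesis
    by (simp add: bump_def)
qed

lemma bump_eq_0: "0 \<le> s \<Longrightarrow> s \<le> 1 / 3 \<Longrightarrow> bump s = 0"
  using cos_monotone_0_pi_le[of "pi * s" "pi / 3"] by (simp add: bump_def cos_60)

lemma bump_eq_1: "2 / 3 \<le> s \<Longrightarrow> s \<le> 1 \<Longrightarrow> bump s = 1"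
  using cos_monotone_0_pi_le[of "2 * pi / 3" "pi * s"] by (simp add: bump_def cos_120)

section \<open>Points of the Cantor set and their digits\<close>

definition ternary :: "(nat \<Rightarrow> bool) \<Rightarrow> real" where
  "ternary a = (\<Sum>k. 2 * of_bool (a k) / 3 ^ Suc k)"

lemma summable_ternary: "summable (\<lambda>k. 2 * of_bool (a k) / 3 ^ Suc k :: real)"
proof (rule summable_comparison_test')
  show "summable (\<lambda>k. (1 / 3) ^ k :: real)"
    by (simp add: summable_geometric)
qed (auto simp: power_divide of_bool_def divide_simps)

lemma ternary_shift: "ternary a = 2 * of_bool (a 0) / 3 + ternary (\<lambda>k. a (Suc k)) / 3"
  using suminf_split_head[OF summable_ternary[of a]]
    suminf_divide[OF summable_ternary[of "\<lambda>k. a (Suc k)"], of 3]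
  by (simp add: ternary_def mult.commute)

lemma ternary_bounds: "0 \<le> ternary a" "ternary a \<le> 1"
proof -
  show "0 \<le> ternary a"
    unfolding ternary_def by (intro suminf_nonneg summable_ternary) auto
  have s: "(\<lambda>k. 2 / 3 * (1 / 3) ^ k :: real) sums (2 / 3 * (1 / (1 - 1 / 3)))"
    by (intro sums_mult geometric_sums) auto
  have "ternary a \<le> (\<Sum>k. 2 / 3 * (1 / 3) ^ k)"
    unfolding ternary_def
    by (intro suminf_le summable_ternary sums_summable[OF s]) (auto simp: power_divide)
  also have "\<dots> = 1"
    using sums_unique[OF s] by simp
  finally show "ternary a \<le> 1" .
qed

text \<open>Multiplication by \<open>3 ^ m\<close> moves \<open>m\<close> digits in front of the
  ternary point. As these are 0 or 2, they form an even integer, which the period of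
  \<open>bump\<close> removes. The rest lies in \<open>[0, 1/3]\<close> or \<open>[2/3, 1]\<close>
  according to digit \<open>m\<close>.\<close>

lemma bump_ternary: "bump (3 ^ m * ternary a) = of_bool (a m)"
proof -
  have "\<exists>N::nat. 3 ^ m * ternary a = 2 * real N + ternary (\<lambda>k. a (m + k))"
  proof (induction m)
    case 0
    show ?case by (auto intro: exI[of _ 0])
  next
    case (Suc m)
    then obtain N :: nat where N: "3 ^ m * ternary a = 2 * real N + ternary (\<lambda>k. a (m + k))"
      by blast
    have "3 ^ Suc m * ternary a = 2 * real (3 * N + of_bool (a m)) + ternary (\<lambda>k. a (Suc m + k))"
      using N ternary_shift[of "\<lambda>k. a (m + k)"] by (simp add: algebra_simps)
    then show ?case by blast
  qed
  then have "bump (3 ^ m * ternary a) = bump (ternary (\<lambda>k. a (m + k)))"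
    using bump_add_even by metis
  also have "\<dots> = of_bool (a m)"
    using ternary_bounds[of "\<lambda>k. a (m + Suc k)"] ternary_shift[of "\<lambda>k. a (m + k)"]
    by (cases "a m") (auto intro!: bump_eq_0 bump_eq_1)
  finally show ?thesis .
qed

text \<open>The digits are the parities of the floors of \<open>2 ^ Suc k * y\<close>, so the
  partial sums are the dyadic truncations of \<open>y\<close>, which are within
  \<open>(1 / 2) ^ n\<close> of it. The bound \<open>y < 1\<close> makes the truncation for
  \<open>n = 0\<close> vanish, as an empty sum must.\<close>

lemma binary_expansion:
  fixes y :: real
  assumes "0 \<le> y" "y < 1"
  obtains a :: "nat \<Rightarrow> bool" where "(\<lambda>k. of_bool (a k) / 2 ^ Suc k) sums y"
proof
  define a where "a k = odd \<lfloor>2 ^ Suc k * y\<rfloor>" for k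
  have step: "\<lfloor>2 ^ Suc k * y\<rfloor> = 2 * \<lfloor>2 ^ k * y\<rfloor> + of_bool (a k)" for k
  proof -
    have "\<lfloor>2 ^ k * y\<rfloor> = \<lfloor>2 ^ Suc k * y\<rfloor> div 2"
      using floor_divide_real_eq_div[of 2 "2 ^ Suc k * y"] by simp
    then show ?thesis
      by (simp add: a_def)
  qed
  have part: "(\<Sum>k<n. of_bool (a k) / 2 ^ Suc k) = real_of_int \<lfloor>2 ^ n * y\<rfloor> / 2 ^ n" for n
  proof (induction n)
    case 0
    then show ?case using assms by (simp add: floor_eq_iff)
  next
    case (Suc n)
    then show ?case by (simp only: step sum.lessThan_Suc) (simp add: field_simps)
  qed
  have "(\<lambda>n. real_of_int \<lfloor>2 ^ n * y\<rfloor> / 2 ^ n) \<longlonglongrightarrow> y"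
  proof (rule tendsto_sandwich)
    show "\<forall>\<^sub>F n in sequentially. y - (1 / 2) ^ n \<le> real_of_int \<lfloor>2 ^ n * y\<rfloor> / 2 ^ n"
    proof (intro always_eventually allI)
      fix n
      have "2 ^ n * y - 1 \<le> real_of_int \<lfloor>2 ^ n * y\<rfloor>" by linarith
      then have "(2 ^ n * y - 1) / 2 ^ n \<le> real_of_int \<lfloor>2 ^ n * y\<rfloor> / 2 ^ n"
        by (rule divide_right_mono) simp
      then show "y - (1 / 2) ^ n \<le> real_of_int \<lfloor>2 ^ n * y\<rfloor> / 2 ^ n"
        by (simp add: diff_divide_distrib power_divide)
    qed
    show "\<forall>\<^sub>F n in sequentially. real_of_int \<lfloor>2 ^ n * y\<rfloor> / 2 ^ n \<le> y"
    proof (intro always_eventually allI)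
      fix n
      have "real_of_int \<lfloor>2 ^ n * y\<rfloor> \<le> 2 ^ n * y" by linarith
      then show "real_of_int \<lfloor>2 ^ n * y\<rfloor> / 2 ^ n \<le> y"
        by (simp add: field_simps)
    qed
    have "(\<lambda>n. y - (1 / 2) ^ n) \<longlonglongrightarrow> y - 0"
      by (intro tendsto_intros LIMSEQ_power_zero) auto
    then show "(\<lambda>n. y - (1 / 2) ^ n) \<longlonglongrightarrow> y" by simp
  qed auto
  then show "(\<lambda>k. of_bool (a k) / 2 ^ Suc k) sums y"
    by (simp only: sums_def part)
qed

text \<open>Schoenberg's curve: its coordinates at \<open>ternary a\<close> are read off from disjoint subsequences of
  the digits \<open>a\<close>.\<close>

lemma space_filling_curve:
  fixes K :: "'a::euclidean_space set"
  assumes "bounded K"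
  obtains \<phi> :: "real \<Rightarrow> 'a" where "continuous_on UNIV \<phi>" "K \<subseteq> \<phi> ` {0..1}"
proof -
  obtain B where B: "B > 0" "\<And>x. x \<in> K \<Longrightarrow> norm x < B"
    using assms bounded_pos_less by blast
  obtain c :: "'a \<Rightarrow> nat" where c: "inj_on c Basis"
    using finite_imp_inj_to_nat_seg[OF finite_Basis] by blast
  define h where "h b k t = bump (3 ^ prod_encode (c b, k) * t) / 2 ^ Suc k" for b k t
  \<comment> \<open>Each series has values in \<open>[0, 1]\<close>; the affine map stretches this
    interval to \<open>[-B, B]\<close>, which contains every coordinate of every point of
    \<open>K\<close>.\<close>
  define \<phi> where "\<phi> t = (\<Sum>b\<in>Basis. (B * (2 * (\<Sum>k. h b k t) - 1)) *\<^sub>R b)" for t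
  show ?thesis
  proof
    have "continuous_on UNIV (\<lambda>t. \<Sum>k. h b k t)" for b
    proof (rule uniform_limit_theorem)
      show "uniform_limit UNIV (\<lambda>n t. \<Sum>k<n. h b k t) (\<lambda>t. \<Sum>k. h b k t) sequentially"
      proof (rule Weierstrass_m_test)
        show "norm (h b k t) \<le> (1 / 2) ^ k" for k t
        proof -
          have "norm (h b k t) \<le> 1 / 2 ^ Suc k"
            unfolding h_def using bump_bounds by (simp add: divide_right_mono)
          also have "\<dots> \<le> (1 / 2) ^ k"
            by (simp add: power_divide field_simps)
          finally show ?thesis .
        qed
      qed (simp add: summable_geometric)
      show "\<forall>\<^sub>F n in sequentially. continuous_on UNIV (\<lambda>t. \<Sum>k<n. h b k t)"
        unfolding h_def by (intro always_eventually allI continuous_intros) auto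
    qed auto
    then show "continuous_on UNIV \<phi>"
      unfolding \<phi>_def by (intro continuous_intros)
    show "K \<subseteq> \<phi> ` {0..1}"
    proof
      fix x assume x: "x \<in> K"
      \<comment> \<open>This inverts the affine map in \<phi>. The strict bound
        \<open>norm x < B\<close> gives \<open>y b < 1\<close>, as the binary expansion
        requires.\<close>
      define y where "y b = (x \<bullet> b / B + 1) / 2" for b
      have y: "0 \<le> y b" "y b < 1" if "b \<in> Basis" for b
        using Basis_le_norm[OF that, of x] B(1) B(2)[OF x]
        by (auto simp: y_def field_simps abs_le_iff)
      have "\<exists>a. \<forall>b\<in>Basis. (\<lambda>k. of_bool (a b k) / 2 ^ Suc k) sums y b"
        by (rule bchoice, rule ballI) (metis binary_expansion y)
      then obtain a where a: "\<And>b. b \<in> Basis \<Longrightarrow> (\<lambda>k. of_bool (a b k) / 2 ^ Suc k) sums y b"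
        by blast
      \<comment> \<open>The binary expansions of all coordinates are interleaved into one digit
        sequence. Positions whose first component is not a number \<open>c b\<close> hold arbitrary
        digits, which no coordinate reads.\<close>
      define d where
        "d m = (case prod_decode m of (i, k) \<Rightarrow> a (inv_into Basis c i) k)" for m
      have "(\<Sum>k. h b k (ternary d)) = y b" if "b \<in> Basis" for b
        using a[OF that] c that
        by (simp add: h_def bump_ternary d_def inv_into_f_f sums_unique[symmetric])
      then have "\<phi> (ternary d) = (\<Sum>b\<in>Basis. (x \<bullet> b) *\<^sub>R b)"
        unfolding \<phi>_def using B(1) by (intro sum.cong refl) (simp add: y_def field_simps)
      then have "x = \<phi> (ternary d)"
        by (simp add: euclidean_representation)
      then show "x \<in> \<phi> ` {0..1}"
        using ternary_bounds by auto
    qed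
  qed
qed

section \<open>A measurable right inverse of the curve\<close>

lemma borel_section:
  fixes \<phi> :: "real \<Rightarrow> 'a::{t2_space}"
  assumes "continuous_on {0..1} \<phi>"
  obtains s :: "'a \<Rightarrow> real" where "s \<in> borel_measurable borel" "\<And>x. 0 \<le> s x" "\<And>x. s x \<le> 2"
    "\<And>x. x \<in> \<phi> ` {0..1} \<Longrightarrow> \<phi> (s x) = x"
proof
  define T where "T x = {t \<in> {0..1}. \<phi> t = x}" for x
  \<comment> \<open>The default 2 lies beyond the parameter interval, so for \<open>u < 2\<close> no
    point off the image enters the sublevel set at \<open>u\<close>.\<close>
  define s where "s x = (if x \<in> \<phi> ` {0..1} then Inf (T x) else 2)" for x
  have s: "s x \<in> T x" "\<And>t. t \<in> T x \<Longrightarrow> s x \<le> t" if x: "x \<in> \<phi> ` {0..1}" for x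
  proof -
    have "closed (T x)"
      using continuous_closed_preimage[OF assms, of "{x}"]
      by (simp add: T_def vimage_def Int_def)
    moreover have "T x \<noteq> {}" "bdd_below (T x)"
      using x by (auto simp: T_def)
    ultimately show "s x \<in> T x" "\<And>t. t \<in> T x \<Longrightarrow> s x \<le> t"
      using x by (auto simp: s_def intro: closed_contains_Inf cInf_lower)
  qed
  have s2: "s x = 2" if "x \<notin> \<phi> ` {0..1}" for x
    using that by (simp add: s_def)
  show "0 \<le> s x" "s x \<le> 2" for x
    using s[of x] s2[of x] by (cases "x \<in> \<phi> ` {0..1}"; force simp: T_def)+
  show "\<phi> (s x) = x" if "x \<in> \<phi> ` {0..1}" for x
    using s[OF that] by (simp add: T_def)
  show "s \<in> borel_measurable borel"
    unfolding borel_measurable_iff_le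
  proof
    fix u :: real
    show "{x \<in> space borel. s x \<le> u} \<in> sets borel"
    proof (cases "u < 2")
      case True
      \<comment> \<open>A first hitting time is at most \<open>u\<close> exactly when the curve
        visits the point by time \<open>u\<close>. The sublevel set is therefore the image of a
        compact interval, hence compact and Borel.\<close>
      have "{x. s x \<le> u} = \<phi> ` ({0..1} \<inter> {..u})"
      proof (intro equalityI subsetI)
        fix x assume "x \<in> {x. s x \<le> u}"
        then have "s x \<le> u" "x \<in> \<phi> ` {0..1}"
          using True s2[of x] by force+
        then show "x \<in> \<phi> ` ({0..1} \<inter> {..u})"
          using s(1)[of x] by (auto simp: T_def intro!: image_eqI[of _ _ "s x"])
      next
        fix x assume "x \<in> \<phi> ` ({0..1} \<inter> {..u})"
        then obtain t where "t \<in> T x" "t \<le> u" "x \<in> \<phi> ` {0..1}"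
          by (auto simp: T_def)
        then show "x \<in> {x. s x \<le> u}"
          using s(2)[of x t] by simp
      qed
      moreover have "compact (\<phi> ` ({0..1} \<inter> {..u}))"
        by (intro compact_continuous_image continuous_on_subset[OF assms]) auto
      ultimately show ?thesis
        by (simp add: borel_compact)
    next
      case False
      then have "{x. s x \<le> u} = UNIV"
        using \<open>\<And>x. s x \<le> 2\<close> by (auto intro: order_trans[of _ 2])
      then show ?thesis by simp
    qed
  qed
qed

subsection \<open>Weak limits of measures on a compact set\<close>

text \<open>Since \<phi> inverts \<open>s\<close> on \<open>K\<close>, the integral of
  \<open>g\<close> under \<open>\<nu> k\<close> is that of \<open>g\<close> after \<phi> under the
  image \<open>\<eta> k\<close> of \<open>\<nu> k\<close> on the line. The measures
  \<open>\<eta> k\<close> are tight, and \<open>g\<close> after \<phi> is again bounded and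
  continuous, so weak convergence on the line carries over.\<close>

lemma weak_limit_on_compact:
  fixes \<nu> :: "nat \<Rightarrow> 'a::euclidean_space measure"
  assumes "compact K"
    and "\<And>k. prob_space (\<nu> k)" and sets_\<nu>: "\<And>k. sets (\<nu> k) = sets borel"
    and K: "\<And>k. AE x in \<nu> k. x \<in> K"
  obtains r \<mu> where "strict_mono r" "prob_space \<mu>" "sets \<mu> = sets borel" "AE x in \<mu>. x \<in> K"
    "\<And>g. continuous_on UNIV g \<Longrightarrow> bounded (range g) \<Longrightarrow>
       (\<lambda>k. \<integral>x. g x \<partial>\<nu> (r k)) \<longlonglongrightarrow> (\<integral>x. g x \<partial>\<mu> :: real)"
proof -
  interpret \<nu>: prob_space "\<nu> k" for k by fact
  note [measurable_cong] = sets_\<nu>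
  \<comment> \<open>Nonemptiness matters because \<open>infdist\<close> to the empty set is 0 by
    convention and would not detect membership.\<close>
  have "K \<noteq> {}"
    using K[of 0] \<nu>.AE_False by (metis AE_cong empty_iff)
  obtain \<phi> :: "real \<Rightarrow> 'a" where \<phi>: "continuous_on UNIV \<phi>" "K \<subseteq> \<phi> ` {0..1}"
    by (rule space_filling_curve[OF compact_imp_bounded[OF \<open>compact K\<close>]])
  have [measurable]: "\<phi> \<in> borel_measurable borel"
    using \<phi>(1) by (rule borel_measurable_continuous_onI)
  obtain s where [measurable]: "s \<in> borel_measurable borel"
    and s: "\<And>x. 0 \<le> s x" "\<And>x. s x \<le> 2" "\<And>x. x \<in> \<phi> ` {0..1} \<Longrightarrow> \<phi> (s x) = x"
    using borel_section[OF continuous_on_subset[OF \<phi>(1) subset_UNIV]] by blast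
  define \<eta> where "\<eta> k = distr (\<nu> k) borel s" for k
  have \<eta>: "real_distribution (\<eta> k)" for k
    unfolding \<eta>_def real_distribution_def real_distribution_axioms_def
    by (auto intro!: \<nu>.prob_space_distr)
  have "tight \<eta>"
    unfolding tight_def
  proof (intro conjI allI impI \<eta>)
    fix \<epsilon> :: real assume "0 < \<epsilon>"
    \<comment> \<open>The values of \<open>s\<close> lie in \<open>[0, 2]\<close>; the half-open
      interval starts at -1 in order to contain 0.\<close>
    have "measure (\<eta> n) {- 1<..2} = 1" for n
    proof -
      have "s -` {- 1<..2} \<inter> space (\<nu> n) = space (\<nu> n)"
        using s(1,2) by (auto intro!: less_le_trans[of "-1" 0 "s _"])
      then show ?thesis
        by (simp add: \<eta>_def measure_distr \<nu>.prob_space)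
    qed
    with \<open>0 < \<epsilon>\<close> show "\<exists>a b. a < b \<and> (\<forall>n. 1 - \<epsilon> < measure (\<eta> n) {a<..b})"
      by (intro exI[of _ "-1"] exI[of _ 2]) simp
  qed
  from tight_imp_convergent_subsubsequence[OF this strict_mono_id] obtain r M
    where r: "strict_mono r" and M: "real_distribution M" and conv: "weak_conv_m (\<eta> \<circ> r) M"
    by auto
  interpret M: real_distribution M by fact
  define \<mu> where "\<mu> = distr M borel \<phi>"
  have lim: "(\<lambda>k. \<integral>x. g x \<partial>\<nu> (r k)) \<longlonglongrightarrow> (\<integral>x. g x \<partial>\<mu>)"
    if g: "continuous_on UNIV g" "bounded (range g)" for g :: "'a \<Rightarrow> real"
  proof -
    have [measurable]: "g \<in> borel_measurable borel"
      using g(1) by (rule borel_measurable_continuous_onI)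
    obtain C where C: "\<And>x. norm (g x) \<le> C"
      using g(2) by (auto simp: bounded_iff)
    have cont: "isCont (\<lambda>t. g (\<phi> t)) t" for t
      using continuous_on_compose2[OF g(1) \<phi>(1)] by (auto simp: continuous_on_eq_continuous_at)
    have "(\<lambda>k. \<integral>t. g (\<phi> t) \<partial>(\<eta> \<circ> r) k) \<longlonglongrightarrow> (\<integral>t. g (\<phi> t) \<partial>M)"
      using weak_conv_imp_integral_bdd_continuous_conv[OF _ M conv cont C] \<eta> by simp
    moreover have "(\<integral>t. g (\<phi> t) \<partial>(\<eta> \<circ> r) k) = (\<integral>x. g x \<partial>\<nu> (r k))" for k
    proof -
      have "(\<integral>t. g (\<phi> t) \<partial>(\<eta> \<circ> r) k) = (\<integral>x. g (\<phi> (s x)) \<partial>\<nu> (r k))"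
        by (simp add: \<eta>_def integral_distr)
      also have "\<dots> = (\<integral>x. g x \<partial>\<nu> (r k))"
        using K[of "r k"] by (intro integral_cong_AE) (auto simp: s(3) subsetD[OF \<phi>(2)] elim: AE_mp)
      finally show ?thesis .
    qed
    ultimately show ?thesis
      by (simp add: \<mu>_def integral_distr)
  qed
  show ?thesis
  proof
    show "strict_mono r" "sets \<mu> = sets borel"
      using r by (auto simp: \<mu>_def)
    show "prob_space \<mu>"
      unfolding \<mu>_def by (intro M.prob_space_distr) simp
    then interpret \<mu>: prob_space \<mu> .
    show "(\<lambda>k. \<integral>x. g x \<partial>\<nu> (r k)) \<longlonglongrightarrow> (\<integral>x. g x \<partial>\<mu>)"
      if "continuous_on UNIV g" "bounded (range g)" for g :: "'a \<Rightarrow> real"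
      using that by (rule lim)
    \<comment> \<open>A continuous function vanishing exactly on \<open>K\<close>, truncated at 1 to
      be an admissible test function. Its integrals under all \<open>\<nu> (r k)\<close> are 0,
      hence also its integral under \<mu>, which forces \<mu> to live on \<open>K\<close>.\<close>
    define q :: "'a \<Rightarrow> real" where "q x = min 1 (infdist x K)" for x
    have q: "0 \<le> q x" "q x \<le> 1" for x
      by (auto simp: q_def infdist_nonneg)
    have cq: "continuous_on UNIV q"
      unfolding q_def by (intro continuous_intros)
    then have [measurable]: "q \<in> borel_measurable borel"
      by (rule borel_measurable_continuous_onI)
    have "(\<integral>x. q x \<partial>\<nu> (r k)) = 0" for k
      using K[of "r k"] by (intro integral_eq_zero_AE) (auto simp: q_def elim: AE_mp)
    moreover have "bounded (range q)"
      using q by (auto simp: bounded_iff intro!: exI[of _ 1])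
    ultimately have "(\<integral>x. q x \<partial>\<mu>) = 0"
      using lim[OF cq] by (simp add: LIMSEQ_const_iff)
    moreover have "integrable \<mu> q"
      using q by (intro \<mu>.integrable_const_bound[of _ 1]) (auto simp: \<mu>_def)
    ultimately have "AE x in \<mu>. q x = 0"
      using q by (subst (asm) integral_nonneg_eq_0_iff_AE) auto
    then show "AE x in \<mu>. x \<in> K"
    proof (rule AE_mp, intro AE_I2 impI)
      fix x assume "q x = 0"
      then have "infdist x K = 0"
        by (simp add: q_def min_def split: if_splits)
      then show "x \<in> K"
        using in_closed_iff_infdist_zero[OF compact_imp_closed[OF \<open>compact K\<close>] \<open>K \<noteq> {}\<close>] by blast
    qed
  qed
qed

section \<open>Bounded continuous functions determine a finite Borel measure\<close>

lemma tendsto_indicator_closed: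
  assumes "closed F" "F \<noteq> {}"
  shows "(\<lambda>k. max 0 (1 - real k * infdist x F)) \<longlonglongrightarrow> indicator F x"
proof (cases "x \<in> F")
  case False
  then have "0 < infdist x F"
    using assms in_closed_iff_infdist_zero[of F x] infdist_nonneg[of x F] by force
  then obtain N :: nat where N: "1 < real N * infdist x F"
    using ex_less_of_nat_mult by blast
  have "max 0 (1 - real k * infdist x F) = 0" if "k \<ge> N" for k
  proof -
    have "real N * infdist x F \<le> real k * infdist x F"
      using that by (intro mult_right_mono) (auto simp: infdist_nonneg)
    with N show ?thesis by simp
  qed
  then have "\<forall>\<^sub>F k in sequentially. max 0 (1 - real k * infdist x F) = 0"
    unfolding eventually_sequentially by blast
  then show ?thesis
    using False by (simp add: tendsto_eventually)
qed simp

text \<open>The closed sets generate the Borel sets and are stable under intersection. The measure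
  of a nonempty closed set is the limit of integrals of continuous cut-offs of the distance to it,
  so the two measures agree on this generator.\<close>

lemma measure_eqI_continuous:
  fixes M N :: "'a::euclidean_space measure"
  assumes "finite_measure M" "finite_measure N" and sets: "sets M = sets borel" "sets N = sets borel"
    and eq: "\<And>g :: 'a \<Rightarrow> real. continuous_on UNIV g \<Longrightarrow> bounded (range g) \<Longrightarrow>
      (\<integral>x. g x \<partial>M) = (\<integral>x. g x \<partial>N)"
  shows "M = N"
proof -
  interpret M: finite_measure M by fact
  interpret N: finite_measure N by fact
  have lim: "(\<lambda>k. \<integral>x. max 0 (1 - real k * infdist x F) \<partial>L) \<longlonglongrightarrow> measure L F"
    if F: "closed F" "F \<noteq> {}" and L: "finite_measure L" "sets L = sets borel"
    for F and L :: "'a measure"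
  proof -
    interpret L: finite_measure L by fact
    have "(\<lambda>k. \<integral>x. max 0 (1 - real k * infdist x F) \<partial>L) \<longlonglongrightarrow> (\<integral>x. indicator F x \<partial>L)"
    proof (rule integral_dominated_convergence)
      show "AE x in L. (\<lambda>k. max 0 (1 - real k * infdist x F)) \<longlonglongrightarrow> indicator F x"
        using F by (intro AE_I2 tendsto_indicator_closed)
      show "AE x in L. norm (max 0 (1 - real k * infdist x F)) \<le> 1" for k
        by (auto simp: infdist_nonneg)
    qed (use F in \<open>auto simp: measurable_cong_sets[OF L(2) refl]
        intro!: borel_measurable_continuous_onI continuous_intros borel_closed\<close>)
    then show ?thesis
      using F L by (simp add: borel_closed)
  qed
  have "emeasure M F = emeasure N F" if "F \<in> Collect closed" for F
  proof (cases "F = {}")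
    case False
    have "(\<integral>x. max 0 (1 - real k * infdist x F) \<partial>M) = (\<integral>x. max 0 (1 - real k * infdist x F) \<partial>N)"
      for k
      by (intro eq continuous_intros) (auto simp: bounded_iff infdist_nonneg intro!: exI[of _ 1])
    then have "measure M F = measure N F"
      using lim[of F M] lim[of F N] that False assms(1,2) sets LIMSEQ_unique by simp blast
    then show ?thesis
      by (simp add: M.emeasure_eq_measure N.emeasure_eq_measure)
  qed simp
  then show ?thesis
    by (intro measure_eqI_generator_eq[of "Collect closed" UNIV M N "\<lambda>_. UNIV"])
      (auto simp: sets Int_stable_def borel_eq_closed)
qed

subsection \<open>Configurations\<close>

text \<open>If \<open>h\<close> is not integrable, its integral is 0 by convention and the bound at
  any point gives \<open>0 \<le> C\<close>. The bounds on \<open>markov_op\<close> and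
  \<open>expected\<close> then hold at every point, also outside
  \<open>config_space\<close>.\<close>

lemma (in prob_space) abs_integral_le:
  fixes h :: "'a \<Rightarrow> real"
  assumes "\<And>x. \<bar>h x\<bar> \<le> C"
  shows "\<bar>\<integral>x. h x \<partial>M\<bar> \<le> C"
proof (cases "integrable M h")
  case True
  have "\<bar>\<integral>x. h x \<partial>M\<bar> \<le> (\<integral>x. \<bar>h x\<bar> \<partial>M)"
    by (rule integral_abs_bound)
  also have "\<dots> \<le> C"
    using True assms by (intro integral_le_const AE_I2 integrable_abs)
  finally show ?thesis .
next
  case False
  then show ?thesis
    using assms[of undefined] by (simp add: not_integrable_integral_eq)
qed

lemma compact_config_space: "compact (config_space :: ((real^'d)^'n) set)"
proof -
  have "norm z \<le> real CARD('n)" if "z \<in> config_space" for z :: "(real^'d)^'n"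
  proof -
    have "norm z \<le> (\<Sum>i\<in>UNIV. norm (z $ i))"
      unfolding norm_vec_def by (intro L2_set_le_sum) auto
    also have "\<dots> = real CARD('n)"
      using that by (simp add: config_space_def)
    finally show ?thesis .
  qed
  moreover have "closed (config_space :: ((real^'d)^'n) set)"
    unfolding config_space_def mem_sphere_0
    by (intro closed_Collect_all closed_Collect_eq continuous_intros)
  ultimately show ?thesis
    by (auto simp: compact_eq_bounded_closed bounded_iff)
qed

text \<open>The set is a finite union, over the sign patterns, of continuous images of the
  sphere.\<close>

lemma compact_polar_set: "compact (polar_set :: ((real^'d)^'n) set)"
proof -
  define \<Sigma> where "\<Sigma> = {\<sigma> :: 'n \<Rightarrow> real. \<forall>i. \<sigma> i \<in> {- 1, 1}}"
  have "\<Sigma> = (\<Pi>\<^sub>E i\<in>UNIV. {- 1, 1})"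
    by (auto simp: \<Sigma>_def PiE_iff)
  then have "finite \<Sigma>"
    by (simp add: finite_PiE)
  moreover have "compact ((\<lambda>x::real^'d. \<chi> i::'n. \<sigma> i *\<^sub>R x) ` sphere 0 1)" for \<sigma>
    by (intro compact_continuous_image continuous_intros compact_sphere)
  ultimately have "compact (\<Union>\<sigma>\<in>\<Sigma>. (\<lambda>x::real^'d. \<chi> i::'n. \<sigma> i *\<^sub>R x) ` sphere 0 1)"
    by (intro compact_UN) auto
  moreover have "polar_set = (\<Union>\<sigma>\<in>\<Sigma>. (\<lambda>x::real^'d. \<chi> i::'n. \<sigma> i *\<^sub>R x) ` sphere 0 1)"
    by (auto simp: polar_set_def \<Sigma>_def)
  ultimately show ?thesis by simp
qed

lemma polar_set_subset: "polar_set \<subseteq> config_space"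
proof
  fix z :: "(real^'d)^'n" assume "z \<in> polar_set"
  then obtain x and \<sigma> :: "'n \<Rightarrow> real" where "norm x = 1" "\<And>i. \<sigma> i \<in> {- 1, 1}"
    and "z = (\<chi> i. \<sigma> i *\<^sub>R x)"
    unfolding polar_set_def Bex_def mem_sphere_0 mem_Collect_eq by blast
  moreover from this have "\<bar>\<sigma> i\<bar> = 1" for i
    by (metis abs_1 abs_minus insertE singletonD)
  ultimately show "z \<in> config_space"
    by (simp add: config_space_def)
qed

lemma polar_set_nonempty: "(polar_set :: ((real^'d)^'n) set) \<noteq> {}"
proof -
  obtain x :: "real^'d" where "norm x = 1"
    using vector_choose_size[of 1] by auto
  then have "(\<chi> i::'n. (1::real) *\<^sub>R x) \<in> polar_set"
    unfolding polar_set_def mem_Collect_eq mem_sphere_0 Bex_def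
    by (intro exI[of _ x] exI[of _ "\<lambda>_. 1"] conjI refl) simp_all
  then show ?thesis by blast
qed

lemma sets_polar_nbhd: "polar_nbhd \<epsilon> \<in> sets borel"
  unfolding polar_nbhd_def
  by (intro borel_closed closed_Collect_le continuous_intros)

lemma sets_config_space: "config_space \<in> sets borel"
  by (intro borel_compact compact_config_space)

lemma norm_proj_sphere: "v \<noteq> 0 \<Longrightarrow> norm (proj_sphere v) = 1"
  by (simp add: proj_sphere_def)

text \<open>The recursion of \<open>god_traj\<close> splits off the last noise value; this splits
  off the first one, as the Markov property at time 1 demands.\<close>

lemma god_traj_case_nat:
  "god_traj f x (Suc t) (case_nat \<xi> \<omega>) = god_traj f (god_step f x \<xi>) t \<omega>"
  by (induction t) auto

abbreviation config_borel :: "((real^'d)^'n) measure" where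
  "config_borel \<equiv> restrict_space borel config_space"

lemma borel_measurable_config: "g \<in> borel_measurable borel \<Longrightarrow> g \<in> borel_measurable config_borel"
  by (rule measurable_restrict_space1)

subsection \<open>The Markov operator\<close>

locale opinion_dynamics =
  fixes D :: "(real^'d) measure" and f :: "'n \<Rightarrow> (real^'d)^'n \<Rightarrow> real^'d \<Rightarrow> real^'d"
  assumes dyn: "god_dynamics D f"
begin

sublocale D: prob_space D
  using dyn by (simp add: god_dynamics_def)

lemma prob_space_noise: "prob_space (noise_space D)"
  unfolding noise_space_def by (intro prob_space_PiM D.prob_space_axioms)

sublocale N: prob_space "noise_space D"
  by (rule prob_space_noise)

lemma sets_D: "sets D = sets (restrict_space borel (sphere 0 1))"
  using dyn by (simp add: god_dynamics_def)

lemma space_D: "space D = sphere 0 1"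
  using sets_eq_imp_space_eq[OF sets_D] by (simp add: space_restrict_space)

lemma noise_in_sphere: "\<omega> \<in> space (noise_space D) \<Longrightarrow> \<omega> k \<in> sphere 0 1"
  using space_D by (auto simp: noise_space_def space_PiM PiE_iff)

lemma god_step_in_config:
  "x \<in> config_space \<Longrightarrow> \<xi> \<in> sphere 0 1 \<Longrightarrow> god_step f x \<xi> \<in> config_space"
  using dyn by (simp add: god_dynamics_def god_step_def config_space_def norm_proj_sphere)

lemma god_traj_in_config:
  assumes "x \<in> config_space" "\<omega> \<in> space (noise_space D)"
  shows "god_traj f x t \<omega> \<in> config_space"
  by (induction t) (auto intro!: god_step_in_config assms(1) noise_in_sphere[OF assms(2)] simp del: mem_sphere_0)

lemma measurable_god_step:
  "(\<lambda>(x, \<xi>). god_step f x \<xi>) \<in> config_borel \<Otimes>\<^sub>M D \<rightarrow>\<^sub>M config_borel"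
proof (rule measurable_restrict_space2)
  show "(\<lambda>(x, \<xi>). god_step f x \<xi>) \<in> space (config_borel \<Otimes>\<^sub>M D) \<rightarrow> config_space"
    by (auto simp: space_pair_measure space_restrict_space space_D intro!: god_step_in_config)
  have fst: "fst \<in> config_borel \<Otimes>\<^sub>M D \<rightarrow>\<^sub>M borel"
    by (rule measurable_compose[OF measurable_fst]) (simp add: measurable_restrict_space1)
  have snd: "snd \<in> config_borel \<Otimes>\<^sub>M D \<rightarrow>\<^sub>M borel"
    by (rule measurable_compose[OF measurable_snd])
      (simp add: measurable_cong_sets[OF sets_D refl] measurable_restrict_space1)
  have "(\<lambda>p. (fst p, snd p)) \<in> config_borel \<Otimes>\<^sub>M D \<rightarrow>\<^sub>M borel"
    using fst snd by (rule borel_measurable_Pair)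
  \<comment> \<open>The hypothesis on \<open>f\<close> refers to the Borel sets of a product of
    spaces; the pairing map carries it over to the product sigma-algebra.\<close>
  then have pair: "(\<lambda>p. (fst p, snd p)) \<in>
      config_borel \<Otimes>\<^sub>M D \<rightarrow>\<^sub>M restrict_space borel (config_space \<times> sphere 0 1)"
    by (intro measurable_restrict_space2)
      (auto simp: space_pair_measure space_restrict_space space_D)
  have "(\<lambda>(x, \<xi>). f i x \<xi>) \<in>
      borel_measurable (restrict_space borel (config_space \<times> sphere 0 1))" for i
    using dyn unfolding god_dynamics_def by blast
  from measurable_compose[OF pair this]
  have [measurable]: "(\<lambda>p. f i (fst p) (snd p)) \<in> borel_measurable (config_borel \<Otimes>\<^sub>M D)" for i
    by simp
  have [measurable]: "(\<lambda>p. fst p $ i) \<in> borel_measurable (config_borel \<Otimes>\<^sub>M D)" for i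
    by (rule measurable_compose[OF fst, of "\<lambda>x. x $ i"])
      (intro borel_measurable_continuous_onI continuous_intros)
  show "(\<lambda>(x, \<xi>). god_step f x \<xi>) \<in> borel_measurable (config_borel \<Otimes>\<^sub>M D)"
  proof (subst borel_measurable_euclidean_space, rule ballI)
    fix b :: "(real^'d)^'n" assume "b \<in> Basis"
    then obtain i u where "b = axis i u"
      by (auto simp: Basis_vec_def)
    then have "(\<lambda>p. (case p of (x, \<xi>) \<Rightarrow> god_step f x \<xi>) \<bullet> b) =
        (\<lambda>p. proj_sphere (fst p $ i + f i (fst p) (snd p)) \<bullet> u)"
      by (auto simp: inner_axis god_step_def)
    then show "(\<lambda>p. (case p of (x, \<xi>) \<Rightarrow> god_step f x \<xi>) \<bullet> b) \<in> borel_measurable (config_borel \<Otimes>\<^sub>M D)"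
      by (simp add: proj_sphere_def)
  qed
qed

lemma measurable_god_step':
  "x \<in> config_space \<Longrightarrow> god_step f x \<in> D \<rightarrow>\<^sub>M config_borel"
  using measurable_Pair2[OF measurable_god_step, of x] by (simp add: space_restrict_space)

lemma measurable_god_traj:
  "(\<lambda>(x, \<omega>). god_traj f x t \<omega>) \<in> config_borel \<Otimes>\<^sub>M noise_space D \<rightarrow>\<^sub>M config_borel"
proof (induction t)
  case (Suc t)
  have "(\<lambda>p. snd p t) \<in> config_borel \<Otimes>\<^sub>M noise_space D \<rightarrow>\<^sub>M D"
    unfolding noise_space_def by measurable
  from measurable_compose[OF measurable_Pair[OF Suc this] measurable_god_step]
  show ?case
    by (simp add: case_prod_beta)
qed simp

lemma measurable_god_traj':
  "x \<in> config_space \<Longrightarrow> god_traj f x t \<in> noise_space D \<rightarrow>\<^sub>M config_borel"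
  using measurable_Pair2[OF measurable_god_traj, of x] by (simp add: space_restrict_space)

section \<open>Expectations after one step and after several steps\<close>

definition markov_op :: "((real^'d)^'n \<Rightarrow> real) \<Rightarrow> (real^'d)^'n \<Rightarrow> real" where
  "markov_op g x = (\<integral>\<xi>. g (god_step f x \<xi>) \<partial>D)"

definition expected :: "nat \<Rightarrow> ((real^'d)^'n \<Rightarrow> real) \<Rightarrow> (real^'d)^'n \<Rightarrow> real" where
  "expected t g x = (\<integral>\<omega>. g (god_traj f x t \<omega>) \<partial>noise_space D)"

lemma expected_0: "expected 0 g x = g x"
  by (simp add: expected_def N.prob_space)

lemma borel_measurable_markov_op [measurable]:
  assumes [measurable]: "g \<in> borel_measurable config_borel"
  shows "markov_op g \<in> borel_measurable config_borel"
proof -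
  have "(\<lambda>(x, \<xi>). g (god_step f x \<xi>)) \<in> borel_measurable (config_borel \<Otimes>\<^sub>M D)"
    using measurable_compose[OF measurable_god_step assms] by (simp add: case_prod_beta)
  then show ?thesis
    unfolding markov_op_def by (rule D.borel_measurable_lebesgue_integral)
qed

lemma borel_measurable_expected [measurable]:
  assumes [measurable]: "g \<in> borel_measurable config_borel"
  shows "expected t g \<in> borel_measurable config_borel"
proof -
  have "(\<lambda>(x, \<omega>). g (god_traj f x t \<omega>)) \<in> borel_measurable (config_borel \<Otimes>\<^sub>M noise_space D)"
    using measurable_compose[OF measurable_god_traj assms] by (simp add: case_prod_beta)
  then show ?thesis
    unfolding expected_def by (rule N.borel_measurable_lebesgue_integral)
qed

lemma abs_markov_op_le: "(\<And>x. \<bar>g x\<bar> \<le> C) \<Longrightarrow> \<bar>markov_op g x\<bar> \<le> C"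
  unfolding markov_op_def by (rule D.abs_integral_le)

lemma abs_expected_le: "(\<And>x. \<bar>g x\<bar> \<le> C) \<Longrightarrow> \<bar>expected t g x\<bar> \<le> C"
  unfolding expected_def by (rule N.abs_integral_le)

lemma integrable_god_traj:
  fixes g :: "_ \<Rightarrow> real"
  assumes "x \<in> config_space" "g \<in> borel_measurable config_borel" "\<And>x. \<bar>g x\<bar> \<le> C"
  shows "integrable (noise_space D) (\<lambda>\<omega>. g (god_traj f x t \<omega>))"
proof (rule N.integrable_const_bound[of _ C])
  show "(\<lambda>\<omega>. g (god_traj f x t \<omega>)) \<in> borel_measurable (noise_space D)"
    using measurable_god_traj'[OF assms(1)] assms(2) by (rule measurable_compose)
qed (simp add: assms(3))

text \<open>The Markov property at time 1: prepending an independent value to an i.i.d. sequence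
  leaves its law unchanged, and by Fubini the tail may be integrated first, with the first value
  fixed.\<close>

lemma expected_Suc:
  assumes x: "x \<in> config_space" and g: "g \<in> borel_measurable config_borel" "\<And>x. \<bar>g x\<bar> \<le> C"
  shows "expected (Suc t) g x = markov_op (expected t g) x"
proof -
  interpret sequence_space D
    by unfold_locales
  interpret pair: pair_sigma_finite D "noise_space D"
    by unfold_locales
  have case_nat: "(\<lambda>(\<xi>, \<omega>). case_nat \<xi> \<omega>) \<in> D \<Otimes>\<^sub>M noise_space D \<rightarrow>\<^sub>M noise_space D"
    unfolding noise_space_def by measurable
  have m: "(\<lambda>\<omega>. g (god_traj f x (Suc t) \<omega>)) \<in> borel_measurable (noise_space D)"
    using measurable_compose[OF measurable_god_traj'[OF x] g(1)] .
  have "expected (Suc t) g x =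
      (\<integral>\<omega>. g (god_traj f x (Suc t) \<omega>)
        \<partial>distr (D \<Otimes>\<^sub>M noise_space D) (noise_space D) (\<lambda>(\<xi>, \<omega>). case_nat \<xi> \<omega>))"
    using PiM_iter by (simp add: expected_def noise_space_def)
  also have "\<dots> = (\<integral>p. g (god_traj f (god_step f x (fst p)) t (snd p)) \<partial>(D \<Otimes>\<^sub>M noise_space D))"
    by (subst integral_distr[OF case_nat m])
      (simp add: case_prod_beta god_traj_case_nat del: god_traj.simps)
  also have "\<dots> = (\<integral>\<xi>. \<integral>\<omega>. g (god_traj f (god_step f x \<xi>) t \<omega>) \<partial>noise_space D \<partial>D)"
  proof (subst pair.integral_fst'[symmetric])
    interpret DN: prob_space "D \<Otimes>\<^sub>M noise_space D"
      by (intro prob_space_pair) unfold_locales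
    have "(\<lambda>p. g (god_traj f (god_step f x (fst p)) t (snd p))) \<in>
        borel_measurable (D \<Otimes>\<^sub>M noise_space D)"
      using measurable_compose[OF case_nat m]
      by (simp add: case_prod_beta god_traj_case_nat del: god_traj.simps)
    then show "integrable (D \<Otimes>\<^sub>M noise_space D)
        (\<lambda>p. g (god_traj f (god_step f x (fst p)) t (snd p)))"
      using g(2) by (intro DN.integrable_const_bound[of _ C]) auto
  qed simp
  finally show ?thesis
    by (simp add: markov_op_def expected_def)
qed

lemma markov_op_cong:
  "x \<in> config_space \<Longrightarrow> (\<And>y. y \<in> config_space \<Longrightarrow> g y = h y) \<Longrightarrow> markov_op g x = markov_op h x"
  unfolding markov_op_def
  by (intro Bochner_Integration.integral_cong) (auto simp: space_D god_step_in_config)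

lemma expected_cong:
  "x \<in> config_space \<Longrightarrow> (\<And>y. y \<in> config_space \<Longrightarrow> g y = h y) \<Longrightarrow> expected t g x = expected t h x"
  unfolding expected_def
  by (intro Bochner_Integration.integral_cong) (auto simp: god_traj_in_config)

text \<open>\<open>expected_Suc\<close> applies the operator after the expectation over
  \<open>t\<close> steps; induction shows that applying it before gives the same. Averages of
  \<open>markov_op g\<close> thereby become averages of \<open>g\<close> shifted by one time
  step.\<close>

lemma expected_markov_op:
  assumes "x \<in> config_space" "g \<in> borel_measurable config_borel" "\<And>x. \<bar>g x\<bar> \<le> C"
  shows "expected t (markov_op g) x = expected (Suc t) g x"
  using assms(1)
proof (induction t arbitrary: x)
  case 0
  then show ?case
    using assms(2,3)
    by (subst expected_Suc[where C = C]) (auto simp: expected_0 intro: markov_op_cong)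
next
  case (Suc t)
  have "expected (Suc t) (markov_op g) x = markov_op (expected t (markov_op g)) x"
    using Suc.prems assms(2,3) by (intro expected_Suc[where C = C]) (auto intro: abs_markov_op_le)
  also have "\<dots> = markov_op (expected (Suc t) g) x"
    using Suc by (intro markov_op_cong)
  also have "\<dots> = expected (Suc (Suc t)) g x"
    using Suc.prems assms(2,3) by (intro expected_Suc[where C = C, symmetric])
  finally show ?case .
qed

text \<open>Duality between moving the measure one step forward and applying the Markov operator to
  the function, by change of variables and Fubini.\<close>

lemma integral_distr_god_step:
  assumes "prob_space \<mu>" and sets: "sets \<mu> = sets config_borel"
    and g: "g \<in> borel_measurable config_borel" "\<And>x. \<bar>g x\<bar> \<le> C"
  shows "(\<integral>x. g x \<partial>distr (\<mu> \<Otimes>\<^sub>M D) config_borel (\<lambda>(x, \<xi>). god_step f x \<xi>)) = (\<integral>x. markov_op g x \<partial>\<mu>)"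
proof -
  interpret \<mu>: prob_space \<mu> by fact
  interpret pair_sigma_finite \<mu> D
    by unfold_locales
  interpret P: prob_space "\<mu> \<Otimes>\<^sub>M D"
    by (intro prob_space_pair) unfold_locales
  have step: "(\<lambda>(x, \<xi>). god_step f x \<xi>) \<in> \<mu> \<Otimes>\<^sub>M D \<rightarrow>\<^sub>M config_borel"
    using measurable_god_step by (simp cong: measurable_cong_sets sets_pair_measure_cong add: sets)
  have m: "(\<lambda>(x, \<xi>). g (god_step f x \<xi>)) \<in> borel_measurable (\<mu> \<Otimes>\<^sub>M D)"
    using measurable_compose[OF step g(1)] by (simp add: case_prod_beta)
  have "integrable (\<mu> \<Otimes>\<^sub>M D) (\<lambda>(x, \<xi>). g (god_step f x \<xi>))"
    using m g(2) by (intro P.integrable_const_bound[of _ C]) auto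
  then show ?thesis
    unfolding integral_distr[OF step g(1)] markov_op_def
    by (subst integral_fst) (auto intro!: Bochner_Integration.integral_cong)
qed

text \<open>Each induction step splits off one application of the operator, moves it to the measure
  by duality, and absorbs it by invariance.\<close>

lemma integral_expected_invariant:
  assumes "invariant_distribution D f \<mu>"
    and g: "g \<in> borel_measurable config_borel" "\<And>x. \<bar>g x\<bar> \<le> C"
  shows "(\<integral>x. expected t g x \<partial>\<mu>) = (\<integral>x. g x \<partial>\<mu>)"
proof (induction t)
  case 0
  show ?case by (simp add: expected_0)
next
  case (Suc t)
  have \<mu>: "prob_space \<mu>" "sets \<mu> = sets config_borel"
    "distr (\<mu> \<Otimes>\<^sub>M D) config_borel (\<lambda>(x, \<xi>). god_step f x \<xi>) = \<mu>"
    using assms(1) by (auto simp: invariant_distribution_def)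
  have "(\<integral>x. expected (Suc t) g x \<partial>\<mu>) = (\<integral>x. markov_op (expected t g) x \<partial>\<mu>)"
    using g sets_eq_imp_space_eq[OF \<mu>(2)]
    by (intro Bochner_Integration.integral_cong expected_Suc[where C = C])
      (auto simp: space_restrict_space)
  also have "\<dots> = (\<integral>x. expected t g x \<partial>distr (\<mu> \<Otimes>\<^sub>M D) config_borel (\<lambda>(x, \<xi>). god_step f x \<xi>))"
    using g by (intro integral_distr_god_step[where C = C, symmetric] \<mu>) (auto intro: abs_expected_le)
  also have "\<dots> = (\<integral>x. g x \<partial>\<mu>)"
    using Suc by (simp add: \<mu>(3))
  finally show ?case .
qed

section \<open>Time averages along the chain\<close>

definition time_average :: "nat \<Rightarrow> ((real^'d)^'n \<Rightarrow> real) \<Rightarrow> (real^'d)^'n \<Rightarrow> real" where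
  "time_average T g x = (\<Sum>t\<in>{1..T}. expected t g x) / real T"

lemma weakly_polarizes_iff:
  assumes "x \<in> config_space"
  shows "weakly_polarizes D f x \<longleftrightarrow>
    (\<forall>\<epsilon>>0. (\<lambda>T. time_average T (indicator (polar_nbhd \<epsilon>)) x) \<longlonglongrightarrow> 1)"
proof -
  have "(\<integral>\<omega>. (\<Sum>t\<in>{1..T}. indicator (polar_nbhd \<epsilon>) (god_traj f x t \<omega>) :: real) \<partial>noise_space D) =
      (\<Sum>t\<in>{1..T}. expected t (indicator (polar_nbhd \<epsilon>)) x)" for T \<epsilon>
    unfolding expected_def using assms
    by (intro Bochner_Integration.integral_sum integrable_god_traj[where C = 1]
        borel_measurable_config borel_measurable_indicator sets_polar_nbhd) (auto simp: indicator_def)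
  then show ?thesis
    by (simp add: weakly_polarizes_def time_average_def)
qed

lemma borel_measurable_time_average [measurable]:
  "g \<in> borel_measurable config_borel \<Longrightarrow> time_average T g \<in> borel_measurable config_borel"
  unfolding time_average_def
  by (intro borel_measurable_divide borel_measurable_sum borel_measurable_expected
      borel_measurable_const)

lemma abs_time_average_le:
  assumes "\<And>x. \<bar>g x\<bar> \<le> C"
  shows "\<bar>time_average T g x\<bar> \<le> C"
proof (cases "T = 0")
  case True
  then show ?thesis using assms[of undefined] by (simp add: time_average_def)
next
  case False
  have "\<bar>\<Sum>t\<in>{1..T}. expected t g x\<bar> \<le> (\<Sum>t\<in>{1..T}. C)"
    using abs_expected_le[OF assms] by (intro order_trans[OF sum_abs] sum_mono)
  then show ?thesis
    using False by (simp add: time_average_def field_simps)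
qed

section \<open>From polarization to support on the polar set\<close>

lemma polarizing_imp_supported:
  assumes inv: "invariant_distribution D f \<mu>"
    and pol: "\<And>x. x \<in> config_space \<Longrightarrow> weakly_polarizes D f x"
  shows "AE x in \<mu>. x \<in> polar_set"
proof -
  have \<mu>: "prob_space \<mu>" "sets \<mu> = sets config_borel"
    using inv by (auto simp: invariant_distribution_def)
  interpret \<mu>: prob_space \<mu> by fact
  have space: "space \<mu> = config_space"
    using sets_eq_imp_space_eq[OF \<mu>(2)] by (simp add: space_restrict_space)
  note [measurable_cong] = \<mu>(2)
  have near: "AE x in \<mu>. x \<in> polar_nbhd \<epsilon>" if "0 < \<epsilon>" for \<epsilon>
  proof -
    define I :: "(real^'d)^'n \<Rightarrow> real" where "I = indicator (polar_nbhd \<epsilon>)"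
    have I [measurable]: "I \<in> borel_measurable config_borel" and I1: "\<bar>I x\<bar> \<le> 1" for x
      unfolding I_def
      by (intro borel_measurable_config borel_measurable_indicator sets_polar_nbhd)
        (simp add: indicator_def)
    have lim1: "(\<lambda>T. \<integral>x. time_average T I x \<partial>\<mu>) \<longlonglongrightarrow> (\<integral>x. 1 \<partial>\<mu>)"
    proof (rule integral_dominated_convergence)
      show "AE x in \<mu>. (\<lambda>T. time_average T I x) \<longlonglongrightarrow> 1"
        using pol weakly_polarizes_iff \<open>0 < \<epsilon>\<close> by (intro AE_I2) (auto simp: space I_def)
      show "AE x in \<mu>. norm (time_average T I x) \<le> 1" for T
        using abs_time_average_le[OF I1] by auto
    qed auto
    \<comment> \<open>By invariance the integrated average does not depend on \<open>T\<close>, so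
      its limit 1 is the mass of the neighbourhood. At \<open>T = 0\<close> the average is an empty
      sum divided by 0, hence the restriction.\<close>
    have "(\<integral>x. time_average T I x \<partial>\<mu>) = (\<integral>x. I x \<partial>\<mu>)" if "T \<ge> 1" for T
    proof -
      have int: "integrable \<mu> (expected t I)" for t
        using abs_expected_le[OF I1] by (intro \<mu>.integrable_const_bound[of _ 1]) auto
      have "(\<integral>x. time_average T I x \<partial>\<mu>) = (\<Sum>t\<in>{1..T}. \<integral>x. expected t I x \<partial>\<mu>) / real T"
        using int by (simp add: time_average_def)
      also have "\<dots> = (\<integral>x. I x \<partial>\<mu>)"
        using that by (simp add: integral_expected_invariant[OF inv I I1])
      finally show ?thesis .
    qed
    then have "(\<lambda>T. \<integral>x. time_average T I x \<partial>\<mu>) \<longlonglongrightarrow> (\<integral>x. I x \<partial>\<mu>)"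
      by (intro tendsto_eventually) (auto simp: eventually_sequentially)
    from LIMSEQ_unique[OF this lim1] have "(\<integral>x. I x \<partial>\<mu>) = 1"
      by (simp add: \<mu>.prob_space)
    moreover have iI: "integrable \<mu> I"
      using I1 by (intro \<mu>.integrable_const_bound[of _ 1]) auto
    ultimately have "(\<integral>x. 1 - I x \<partial>\<mu>) = 0"
      by (simp add: \<mu>.prob_space)
    moreover have "integrable \<mu> (\<lambda>x. 1 - I x)"
      using iI by simp
    ultimately have "AE x in \<mu>. 1 - I x = 0"
      by (subst (asm) integral_nonneg_eq_0_iff_AE) (auto simp: I_def indicator_def)
    then show ?thesis
      by (rule AE_mp) (auto simp: I_def indicator_def)
  qed
  \<comment> \<open>Countably many radii keep full mass, and the neighbourhoods shrink to
    \<open>polar_set\<close> because it is closed.\<close>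
  have "AE x in \<mu>. \<forall>k. x \<in> polar_nbhd (1 / real (Suc k))"
    by (subst AE_all_countable) (auto intro!: near)
  then show ?thesis
  proof (rule AE_mp, intro AE_I2 impI)
    fix x assume *: "\<forall>k. x \<in> polar_nbhd (1 / real (Suc k))"
    have "infdist x polar_set \<le> e" if "0 < e" for e
    proof -
      obtain k where "1 / real (Suc k) < e"
        using nat_approx_posE[OF \<open>0 < e\<close>] by blast
      with * show ?thesis
        by (auto simp: polar_nbhd_def intro: order_trans[OF _ less_imp_le])
    qed
    then have "infdist x polar_set = 0"
      using infdist_nonneg[of x polar_set] field_le_epsilon[of "infdist x polar_set" 0]
      by (auto intro!: antisym)
    then show "x \<in> polar_set"
      using in_closed_iff_infdist_zero[OF compact_imp_closed[OF compact_polar_set] polar_set_nonempty]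
      by blast
  qed
qed

subsection \<open>Invariant limits of occupation measures\<close>

text \<open>The Feller property. For fixed noise the step is continuous, since the vectors being
  normalized never vanish; dominated convergence then passes the limit through the integral over the
  noise.\<close>

lemma continuous_on_markov_op:
  assumes f: "\<And>i \<xi>. \<xi> \<in> sphere 0 1 \<Longrightarrow> continuous_on config_space (\<lambda>x. f i x \<xi>)"
    and g: "continuous_on UNIV g" "\<And>x. \<bar>g x\<bar> \<le> C"
  shows "continuous_on config_space (markov_op g)"
  unfolding continuous_on_sequentially
proof (intro ballI allI impI, elim conjE)
  fix a :: "(real^'d)^'n" and X :: "nat \<Rightarrow> (real^'d)^'n"
  assume a: "a \<in> config_space" and X: "\<forall>n. X n \<in> config_space" "X \<longlonglongrightarrow> a"
  have gb: "g \<in> borel_measurable config_borel"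
    using g(1) by (intro borel_measurable_config borel_measurable_continuous_onI)
  have meas: "(\<lambda>\<xi>. g (god_step f x \<xi>)) \<in> borel_measurable D" if "x \<in> config_space" for x
    using measurable_god_step'[OF that] gb by (rule measurable_compose)
  have "(\<lambda>n. \<integral>\<xi>. g (god_step f (X n) \<xi>) \<partial>D) \<longlonglongrightarrow> (\<integral>\<xi>. g (god_step f a \<xi>) \<partial>D)"
  proof (rule integral_dominated_convergence)
    show "AE \<xi> in D. (\<lambda>n. g (god_step f (X n) \<xi>)) \<longlonglongrightarrow> g (god_step f a \<xi>)"
    proof (rule AE_I2)
      fix \<xi> assume "\<xi> \<in> space D"
      then have \<xi>: "\<xi> \<in> sphere 0 1"
        by (simp add: space_D)
      have "x $ i + f i x \<xi> \<noteq> 0" if "x \<in> config_space" for x i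
        using dyn \<xi> that by (auto simp: god_dynamics_def)
      then have "continuous_on config_space (\<lambda>x. god_step f x \<xi>)"
        unfolding god_step_def proj_sphere_def using f[OF \<xi>]
        by (intro continuous_intros) auto
      then have "continuous_on config_space (\<lambda>x. g (god_step f x \<xi>))"
        by (rule continuous_on_compose2[OF g(1)]) simp
      then show "(\<lambda>n. g (god_step f (X n) \<xi>)) \<longlonglongrightarrow> g (god_step f a \<xi>)"
        using a X by (auto simp: continuous_on_sequentially o_def)
    qed
    show "AE \<xi> in D. norm (g (god_step f (X n) \<xi>)) \<le> C" for n
      using g(2) by simp
  qed (use meas a X in auto)
  then show "(markov_op g \<circ> X) \<longlonglongrightarrow> markov_op g a"
    by (simp add: markov_op_def o_def)
qed

text \<open>The average of the laws at times 1 to \<open>T\<close> is encoded as the law of the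
  trajectory at an independent uniform random time, which makes it a push-forward. At
  \<open>T = 0\<close> the time has an unspecified distribution, but the result is still a
  probability measure.\<close>

definition occupation :: "nat \<Rightarrow> (real^'d)^'n \<Rightarrow> ((real^'d)^'n) measure" where
  "occupation T x = distr (measure_pmf (pmf_of_set {1..T}) \<Otimes>\<^sub>M noise_space D) borel
     (\<lambda>(t, \<omega>). god_traj f x t \<omega>)"

context
  fixes x :: "(real^'d)^'n"
  assumes x: "x \<in> config_space"
begin

text \<open>Time is discrete and countable, so joint measurability reduces to measurability at each
  fixed time.\<close>

lemma measurable_god_traj_time:
  "(\<lambda>(t, \<omega>). god_traj f x t \<omega>) \<in> measure_pmf p \<Otimes>\<^sub>M noise_space D \<rightarrow>\<^sub>M borel"
proof -
  have "god_traj f x t \<in> noise_space D \<rightarrow>\<^sub>M borel" for t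
    using measurable_god_traj'[OF x, of t]
    by (auto simp: measurable_restrict_space2_iff)
  then have "(\<lambda>(t, \<omega>). god_traj f x t \<omega>) \<in> count_space UNIV \<Otimes>\<^sub>M noise_space D \<rightarrow>\<^sub>M borel"
    by (intro measurable_pair_measure_countable1) auto
  then show ?thesis
    by (simp cong: measurable_cong_sets sets_pair_measure_cong)
qed

lemma prob_space_occupation: "prob_space (occupation T x)"
proof -
  interpret P: prob_space "measure_pmf (pmf_of_set {1..T}) \<Otimes>\<^sub>M noise_space D"
    by (intro prob_space_pair prob_space_measure_pmf prob_space_noise)
  show ?thesis
    unfolding occupation_def by (rule P.prob_space_distr[OF measurable_god_traj_time])
qed

lemma occupation_in_config: "AE y in occupation T x. y \<in> config_space"
  unfolding occupation_def
  by (subst AE_distr_iff[OF measurable_god_traj_time])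
    (auto simp: sets_config_space space_pair_measure god_traj_in_config[OF x])

lemma integral_occupation:
  assumes g: "g \<in> borel_measurable borel" "\<And>y. \<bar>g y\<bar> \<le> C" and "T > 0"
  shows "(\<integral>y. g y \<partial>occupation T x) = time_average T g x"
proof -
  let ?p = "pmf_of_set {1..T}"
  interpret pair_sigma_finite "measure_pmf ?p" "noise_space D"
    by unfold_locales
  interpret P: prob_space "measure_pmf ?p \<Otimes>\<^sub>M noise_space D"
    by (intro prob_space_pair prob_space_measure_pmf prob_space_noise)
  have m: "(\<lambda>(t, \<omega>). g (god_traj f x t \<omega>)) \<in> borel_measurable (measure_pmf ?p \<Otimes>\<^sub>M noise_space D)"
    using measurable_compose[OF measurable_god_traj_time g(1)] by (simp add: case_prod_beta)
  have int: "integrable (measure_pmf ?p \<Otimes>\<^sub>M noise_space D) (\<lambda>(t, \<omega>). g (god_traj f x t \<omega>))"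
    using m g(2) by (intro P.integrable_const_bound[of _ C]) auto
  have "(\<integral>y. g y \<partial>occupation T x) =
      (\<integral>p. (\<lambda>(t, \<omega>). g (god_traj f x t \<omega>)) p \<partial>(measure_pmf ?p \<Otimes>\<^sub>M noise_space D))"
    unfolding occupation_def integral_distr[OF measurable_god_traj_time g(1)]
    by (simp add: case_prod_beta)
  also have "\<dots> = (\<integral>t. expected t g x \<partial>measure_pmf ?p)"
    unfolding expected_def by (rule integral_fst[OF int, symmetric])
  also have "\<dots> = time_average T g x"
    using \<open>T > 0\<close> by (simp add: integral_pmf_of_set time_average_def)
  finally show ?thesis .
qed

text \<open>Applying the operator shifts time by one, so the difference of the sums telescopes to
  two boundary terms, each at most \<open>C\<close> in absolute value. Occupation measures are thus
  asymptotically invariant.\<close>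

lemma time_average_markov_op:
  assumes g: "g \<in> borel_measurable config_borel" "\<And>y. \<bar>g y\<bar> \<le> C"
  shows "\<bar>time_average T (markov_op g) x - time_average T g x\<bar> \<le> 2 * C / real T"
proof -
  have bound: "\<bar>expected t g x\<bar> \<le> C" for t
    using g(2) by (rule abs_expected_le)
  have "(\<Sum>t\<in>{1..T}. expected t (markov_op g) x) - (\<Sum>t\<in>{1..T}. expected t g x) =
      (\<Sum>t\<in>{1..T}. expected (Suc t) g x - expected t g x)"
    using expected_markov_op[OF x g] by (simp add: sum_subtractf)
  also have "\<dots> = expected (Suc T) g x - expected 1 g x"
    using sum_Suc_diff[of 1 T "\<lambda>t. expected t g x"] by simp
  also have "\<bar>\<dots>\<bar> \<le> 2 * C"
    using bound[of "Suc T"] bound[of 1] by linarith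
  finally show ?thesis
    by (simp add: time_average_def diff_divide_distrib[symmetric] divide_right_mono)
qed

end

text \<open>By duality the hypothesis says that \<mu> and its one-step image integrate bounded
  continuous functions alike. Both are pushed along the identity to Borel measures on the whole
  space, where such functions determine the measure.\<close>

lemma invariant_distributionI:
  assumes "prob_space \<mu>" and sets: "sets \<mu> = sets config_borel"
    and eq: "\<And>g C. continuous_on UNIV g \<Longrightarrow> (\<And>x. \<bar>g x\<bar> \<le> C) \<Longrightarrow>
      (\<integral>x. markov_op g x \<partial>\<mu>) = (\<integral>x. g x \<partial>\<mu>)"
  shows "invariant_distribution D f \<mu>"
proof -
  interpret \<mu>: prob_space \<mu> by fact
  define L where "L = distr (\<mu> \<Otimes>\<^sub>M D) config_borel (\<lambda>(x, \<xi>). god_step f x \<xi>)"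
  interpret P: prob_space "\<mu> \<Otimes>\<^sub>M D"
    by (intro prob_space_pair \<mu>.prob_space_axioms D.prob_space_axioms)
  have "(\<lambda>(x, \<xi>). god_step f x \<xi>) \<in> \<mu> \<Otimes>\<^sub>M D \<rightarrow>\<^sub>M config_borel"
    using measurable_god_step by (simp cong: measurable_cong_sets sets_pair_measure_cong add: sets)
  then interpret L: prob_space L
    unfolding L_def by (rule P.prob_space_distr)
  have sets_L: "sets L = sets config_borel"
    by (simp add: L_def)
  have id: "(\<lambda>x. x) \<in> M \<rightarrow>\<^sub>M borel" if "sets M = sets config_borel"
    for M :: "((real^'d)^'n) measure"
    by (subst measurable_cong_sets[OF that refl]) (simp add: measurable_restrict_space1)
  have "distr L borel (\<lambda>x. x) = distr \<mu> borel (\<lambda>x. x)"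
  proof (rule measure_eqI_continuous)
    show "finite_measure (distr L borel (\<lambda>x. x))" "finite_measure (distr \<mu> borel (\<lambda>x. x))"
      using id sets sets_L by (auto intro!: L.finite_measure_distr \<mu>.finite_measure_distr)
    fix g :: "(real^'d)^'n \<Rightarrow> real"
    assume g: "continuous_on UNIV g" "bounded (range g)"
    then obtain C where C: "\<And>x. \<bar>g x\<bar> \<le> C"
      by (auto simp: bounded_iff)
    have m: "g \<in> borel_measurable borel"
      using g(1) by (rule borel_measurable_continuous_onI)
    have "(\<integral>x. g x \<partial>L) = (\<integral>x. g x \<partial>\<mu>)"
      unfolding L_def
      using integral_distr_god_step[OF \<open>prob_space \<mu>\<close> sets borel_measurable_config[OF m] C]
        eq[OF g(1) C] by simp
    then show "(\<integral>x. g x \<partial>distr L borel (\<lambda>x. x)) = (\<integral>x. g x \<partial>distr \<mu> borel (\<lambda>x. x))"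
      using m by (simp add: integral_distr[OF id] sets sets_L)
  qed simp_all
  moreover have "emeasure (distr M borel (\<lambda>x. x)) A = emeasure M A"
    if "sets M = sets config_borel" "A \<in> sets config_borel"
    for M :: "((real^'d)^'n) measure" and A
  proof -
    have "A \<in> sets borel" "A \<subseteq> config_space"
      using that(2) by (auto simp: sets_restrict_space_iff sets_config_space)
    moreover have "space M = config_space"
      using sets_eq_imp_space_eq[OF that(1)] by (simp add: space_restrict_space)
    ultimately show ?thesis
      by (simp add: emeasure_distr[OF id[OF that(1)]] Int_absorb2)
  qed
  ultimately have "L = \<mu>"
    using sets sets_L by (intro measure_eqI) (auto, metis)
  then show ?thesis
    using assms(1) sets by (simp add: invariant_distribution_def L_def)
qed

text \<open>Krylov--Bogolyubov: a weak limit of occupation measures along a subsequence is invariant,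
  since continuity of the dynamics makes the Markov operator preserve continuous test functions.\<close>

lemma invariant_limit_of_time_averages:
  assumes f: "\<And>i \<xi>. \<xi> \<in> sphere 0 1 \<Longrightarrow> continuous_on config_space (\<lambda>x. f i x \<xi>)"
    and x: "x \<in> config_space" and s: "filterlim s at_top sequentially"
  obtains r \<mu> where "strict_mono r" "invariant_distribution D f \<mu>"
    "\<And>g C. continuous_on UNIV g \<Longrightarrow> (\<And>y. \<bar>g y\<bar> \<le> C) \<Longrightarrow>
       (\<lambda>k. time_average (s (r k)) g x) \<longlonglongrightarrow> (\<integral>y. g y \<partial>\<mu>)"
proof -
  obtain r \<mu> where r: "strict_mono r" and "prob_space \<mu>" and sets_\<mu>: "sets \<mu> = sets borel"
    and \<mu>_config: "AE y in \<mu>. y \<in> config_space"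
    and lim: "\<And>g :: _ \<Rightarrow> real. continuous_on UNIV g \<Longrightarrow> bounded (range g) \<Longrightarrow>
       (\<lambda>k. \<integral>y. g y \<partial>occupation (s (r k)) x) \<longlonglongrightarrow> (\<integral>y. g y \<partial>\<mu>)"
    by (rule weak_limit_on_compact[of config_space "\<lambda>k. occupation (s k) x"])
      (auto simp: compact_config_space prob_space_occupation[OF x] occupation_in_config[OF x]
        occupation_def[THEN arg_cong[where f = sets]])
  interpret \<mu>: prob_space \<mu> by fact
  have sr: "filterlim (\<lambda>k. s (r k)) at_top sequentially"
    using filterlim_compose[OF s filterlim_subseq[OF r]] .
  have avg: "(\<lambda>k. time_average (s (r k)) g x) \<longlonglongrightarrow> (\<integral>y. g y \<partial>\<mu>)"
    if g: "continuous_on UNIV g" "\<And>y. \<bar>g y\<bar> \<le> C" for g C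
  proof (rule Lim_transform_eventually)
    show "(\<lambda>k. \<integral>y. g y \<partial>occupation (s (r k)) x) \<longlonglongrightarrow> (\<integral>y. g y \<partial>\<mu>)"
      using g by (intro lim) (auto simp: bounded_iff)
    have "\<forall>\<^sub>F k in sequentially. 0 < s (r k)"
      using sr eventually_gt_at_top by (rule eventually_compose_filterlim[rotated])
    then show "\<forall>\<^sub>F k in sequentially.
        (\<integral>y. g y \<partial>occupation (s (r k)) x) = time_average (s (r k)) g x"
      by (rule eventually_mono)
        (rule integral_occupation[OF x borel_measurable_continuous_onI[OF g(1)] g(2)])
  qed
  \<comment> \<open>The limit is a measure on the ambient space. Restricting it to the
    configurations, which carry all its mass, gives the sigma-algebra that an invariant distribution
    must have.\<close>
  define \<mu>' where "\<mu>' = restrict_space \<mu> config_space"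
  have config: "config_space \<in> sets \<mu>"
    by (simp add: sets_\<mu> sets_config_space)
  have int: "(\<integral>y. h y \<partial>\<mu>') = (\<integral>y. h y \<partial>\<mu>)" if "h \<in> borel_measurable borel"
    for h :: "(real^'d)^'n \<Rightarrow> real"
  proof -
    note [measurable_cong] = sets_\<mu>
    note [measurable] = that config
    have "(\<integral>y. h y \<partial>\<mu>') = (\<integral>y. indicator config_space y *\<^sub>R h y \<partial>\<mu>)"
      unfolding \<mu>'_def by (intro integral_restrict_space sets.Int config sets.top)
    also have "\<dots> = (\<integral>y. h y \<partial>\<mu>)"
    proof (rule integral_cong_AE)
      show "AE y in \<mu>. indicator config_space y *\<^sub>R h y = h y"
        using \<mu>_config by (rule AE_mp) simp
    qed measurable
    finally show ?thesis .
  qed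
  have "prob_space \<mu>'"
    unfolding \<mu>'_def
  proof (rule prob_space_restrict_space[OF config])
    show "emeasure \<mu> config_space = 1"
      using config \<mu>_config by (rule \<mu>.emeasure_eq_1_AE)
  qed
  moreover have "sets \<mu>' = sets config_borel"
    unfolding \<mu>'_def by (rule sets_restrict_space_cong[OF sets_\<mu>])
  ultimately have "invariant_distribution D f \<mu>'"
  proof (rule invariant_distributionI)
    fix g :: "(real^'d)^'n \<Rightarrow> real" and C
    assume g: "continuous_on UNIV g" "\<And>y. \<bar>g y\<bar> \<le> C"
    have gm: "g \<in> borel_measurable borel"
      using g(1) by (rule borel_measurable_continuous_onI)
    have "0 \<le> C"
      using g(2)[of undefined] by simp
    have "continuous_on config_space (markov_op g)"
      using f g by (rule continuous_on_markov_op)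
    moreover have "closedin (top_of_set UNIV) (config_space :: ((real^'d)^'n) set)"
      using compact_imp_closed[OF compact_config_space] by simp
    moreover have "norm (markov_op g y) \<le> C" for y
      using abs_markov_op_le[of g, OF g(2)] by simp
    \<comment> \<open>\<open>markov_op g\<close> is known to be continuous only on
      \<open>config_space\<close>. Its Tietze extension, with the same bound, is a test function on
      the whole space, to which the weak limit applies.\<close>
    ultimately obtain G where G: "continuous_on UNIV G"
      "\<And>y. y \<in> config_space \<Longrightarrow> G y = markov_op g y" "\<And>y. norm (G y) \<le> C"
      using Tietze[OF _ _ \<open>0 \<le> C\<close>] by (metis UNIV_I)
    have Gm: "G \<in> borel_measurable borel"
      using G(1) by (rule borel_measurable_continuous_onI)
    have lim1: "(\<lambda>k. time_average (s (r k)) G x - time_average (s (r k)) g x) \<longlonglongrightarrow>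
        (\<integral>y. G y \<partial>\<mu>) - (\<integral>y. g y \<partial>\<mu>)"
    proof (rule tendsto_diff)
      show "(\<lambda>k. time_average (s (r k)) G x) \<longlonglongrightarrow> (\<integral>y. G y \<partial>\<mu>)"
        using G(1) by (rule avg) (use G(3) in simp)
      show "(\<lambda>k. time_average (s (r k)) g x) \<longlonglongrightarrow> (\<integral>y. g y \<partial>\<mu>)"
        using g by (rule avg)
    qed
    have lim2: "(\<lambda>k. time_average (s (r k)) G x - time_average (s (r k)) g x) \<longlonglongrightarrow> 0"
    proof (rule Lim_null_comparison)
      have "time_average T G x = time_average T (markov_op g) x" for T
        unfolding time_average_def using expected_cong[OF x G(2)] by simp
      then show "\<forall>\<^sub>F k in sequentially.
          norm (time_average (s (r k)) G x - time_average (s (r k)) g x) \<le> 2 * C / real (s (r k))"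
        using time_average_markov_op[OF x borel_measurable_config[OF gm] g(2)] by simp
      show "(\<lambda>k. 2 * C / real (s (r k))) \<longlonglongrightarrow> 0"
        by (intro tendsto_divide_0[OF tendsto_const] filterlim_at_top_imp_at_infinity
            filterlim_compose[OF filterlim_real_sequentially sr])
    qed
    have "(\<integral>y. G y \<partial>\<mu>) = (\<integral>y. g y \<partial>\<mu>)"
      using LIMSEQ_unique[OF lim1 lim2] by simp
    moreover have "(\<integral>y. markov_op g y \<partial>\<mu>') = (\<integral>y. G y \<partial>\<mu>')"
      using G(2) by (intro Bochner_Integration.integral_cong) (auto simp: \<mu>'_def space_restrict_space)
    ultimately show "(\<integral>y. markov_op g y \<partial>\<mu>') = (\<integral>y. g y \<partial>\<mu>')"
      using int[OF gm] int[OF Gm] by simp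
  qed
  moreover have "(\<lambda>k. time_average (s (r k)) g x) \<longlonglongrightarrow> (\<integral>y. g y \<partial>\<mu>')"
    if g: "continuous_on UNIV g" "\<And>y. \<bar>g y\<bar> \<le> C" for g C
    using avg[OF g] int[OF borel_measurable_continuous_onI[OF g(1)]] by simp
  ultimately show ?thesis
    using r that by blast
qed

section \<open>From support on the polar set to polarization\<close>

lemma supported_imp_polarizing:
  assumes f: "\<And>i \<xi>. \<xi> \<in> sphere 0 1 \<Longrightarrow> continuous_on config_space (\<lambda>x. f i x \<xi>)"
    and supp: "\<And>\<mu>. invariant_distribution D f \<mu> \<Longrightarrow> measure \<mu> polar_set = 1"
    and x: "x \<in> config_space"
  shows "weakly_polarizes D f x"
  unfolding weakly_polarizes_iff[OF x]
proof (intro allI impI, rule ccontr)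
  fix \<epsilon> :: real assume "0 < \<epsilon>"
  define I :: "(real^'d)^'n \<Rightarrow> real" where "I = indicator (polar_nbhd \<epsilon>)"
  \<comment> \<open>Weak limits apply to continuous functions only, so the indicator is replaced by
    a continuous minorant that still equals 1 on \<open>polar_set\<close>.\<close>
  define h :: "(real^'d)^'n \<Rightarrow> real" where "h y = max 0 (1 - infdist y polar_set / \<epsilon>)" for y
  have h: "\<bar>h y\<bar> \<le> 1" for y
    using \<open>0 < \<epsilon>\<close> infdist_nonneg[of y polar_set] by (auto simp: h_def)
  have ch: "continuous_on UNIV h"
    unfolding h_def by (intro continuous_intros) (use \<open>0 < \<epsilon>\<close> in auto)
  have hI: "h y \<le> I y" for y
    using \<open>0 < \<epsilon>\<close> infdist_nonneg[of y polar_set]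
    by (auto simp: h_def I_def polar_nbhd_def indicator_def field_simps)
  have I_meas: "I \<in> borel_measurable borel" and I1: "\<bar>I y\<bar> \<le> 1" for y
    unfolding I_def by (intro borel_measurable_indicator sets_polar_nbhd) (simp add: indicator_def)
  have expected_le: "expected t h x \<le> expected t I x" for t
    unfolding expected_def using hI h I1
    by (intro integral_mono integrable_god_traj[where C = 1] x borel_measurable_config I_meas
        borel_measurable_continuous_onI[OF ch]) auto
  assume "\<not> (\<lambda>T. time_average T (indicator (polar_nbhd \<epsilon>)) x) \<longlonglongrightarrow> 1"
  then obtain \<delta> where "0 < \<delta>" and "\<forall>N. \<exists>T\<ge>N. \<delta> \<le> \<bar>time_average T I x - 1\<bar>"
    unfolding LIMSEQ_iff I_def by (auto simp: not_less)
  then obtain s where s: "\<And>N. N \<le> s N" "\<And>N. \<delta> \<le> \<bar>time_average (s N) I x - 1\<bar>"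
    by metis
  have "\<bar>time_average T I x\<bar> \<le> 1" for T
    using I1 by (rule abs_time_average_le)
  \<comment> \<open>Averages of an indicator never exceed 1, so a deviation of at least \<delta>
    from 1 must be downwards.\<close>
  with s(2) have "time_average (s N) I x \<le> 1 - \<delta>" for N
    by (smt (verit))
  then have le: "time_average (s N) h x \<le> 1 - \<delta>" for N
    by (rule order_trans[rotated])
      (auto simp: time_average_def intro!: divide_right_mono sum_mono expected_le)
  have s_lim: "filterlim s at_top sequentially"
    using s(1) by (intro filterlim_at_top_mono[OF filterlim_ident]) auto
  obtain r \<mu>
    where "strict_mono r" and inv: "invariant_distribution D f \<mu>"
      and lim: "\<And>g C. continuous_on UNIV g \<Longrightarrow> (\<And>y. \<bar>g y\<bar> \<le> C) \<Longrightarrow>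
       (\<lambda>k. time_average (s (r k)) g x) \<longlonglongrightarrow> (\<integral>y. g y \<partial>\<mu>)"
    using f x s_lim by (rule invariant_limit_of_time_averages) auto
  have \<mu>: "prob_space \<mu>" "sets \<mu> = sets config_borel"
    using inv by (auto simp: invariant_distribution_def)
  interpret \<mu>: prob_space \<mu> by fact
  have h_meas: "h \<in> borel_measurable \<mu>"
    unfolding measurable_cong_sets[OF \<mu>(2) refl]
    by (intro borel_measurable_config borel_measurable_continuous_onI ch)
  have "AE y in \<mu>. y \<in> polar_set"
    using supp[OF inv] \<mu>.prob_space by (intro \<mu>.AE_prob_1)
  then have "AE y in \<mu>. h y = 1"
    by (rule AE_mp) (auto simp: h_def)
  then have "(\<integral>y. h y \<partial>\<mu>) = (\<integral>y. 1 \<partial>\<mu>)"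
    using h_meas by (intro integral_cong_AE) auto
  also have "\<dots> = 1"
    by (simp add: \<mu>.prob_space)
  \<comment> \<open>The integral of \<open>h\<close> under the invariant limit is 1 by the support
    hypothesis, yet it is a limit of averages that are at most \<open>1 - \<delta>\<close>.\<close>
  finally have "1 \<le> 1 - \<delta>"
    using LIMSEQ_le_const2[OF lim[OF ch h], of "1 - \<delta>"] le by auto
  with \<open>0 < \<delta>\<close> show False by simp
qed

end

theorem theorem4p7:
  fixes D :: "(real^'d::finite) measure"
    and f :: "'n::finite \<Rightarrow> (real^'d)^'n \<Rightarrow> real^'d \<Rightarrow> real^'d"
  assumes "god_dynamics D f"
  shows "(\<forall>\<mu>. invariant_distribution D f \<mu> \<and> measure \<mu> (config_space - polar_set) > 0
            \<longrightarrow> (\<exists>x0\<in>config_space. \<not> weakly_polarizes D f x0))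
       \<and> ((\<forall>i. \<forall>\<xi>\<in>sphere 0 1. continuous_on config_space (\<lambda>x. f i x \<xi>))
            \<longrightarrow> ((\<forall>x0\<in>config_space. weakly_polarizes D f x0)
                 \<longleftrightarrow> (\<forall>\<mu>. invariant_distribution D f \<mu> \<longrightarrow> measure \<mu> polar_set = 1)))"
proof -
  interpret opinion_dynamics D f
    using assms by unfold_locales
  have polar_sets: "polar_set \<in> sets \<mu>" if "invariant_distribution D f \<mu>" for \<mu>
  proof -
    have "sets \<mu> = sets config_borel"
      using that by (simp add: invariant_distribution_def)
    then show ?thesis
      by (simp add: sets_restrict_space_iff sets_config_space polar_set_subset
          borel_compact[OF compact_polar_set])
  qed
  \<comment> \<open>The first equation is one direction of the equivalence. The second yields the
    first claim by contraposition: positive mass off \<open>polar_set\<close> excludes polarization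
    from every starting point.\<close>
  have full: "measure \<mu> polar_set = 1" "measure \<mu> (config_space - polar_set) = 0"
    if inv: "invariant_distribution D f \<mu>" and pol: "\<forall>x0\<in>config_space. weakly_polarizes D f x0"
    for \<mu>
  proof -
    interpret \<mu>: prob_space \<mu>
      using inv by (simp add: invariant_distribution_def)
    have "sets \<mu> = sets config_borel"
      using inv by (simp add: invariant_distribution_def)
    from sets_eq_imp_space_eq[OF this] have "space \<mu> = config_space"
      by (simp add: space_restrict_space)
    moreover show "measure \<mu> polar_set = 1"
      using polarizing_imp_supported[OF inv] pol polar_sets[OF inv]
      by (subst \<mu>.prob_eq_1) auto
    ultimately show "measure \<mu> (config_space - polar_set) = 0"
      using \<mu>.prob_compl[OF polar_sets[OF inv]] by simp
  qed
  show ?thesis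
    using full supported_imp_polarizing by (metis less_irrefl)
qed

end
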